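(* Fix a node speed $v>0$ and a direction change rate $\tau>0$ (random walk model). As the node density $\nu=\frac{n}{\mathcal{A}}\to 0$, the propagation speed upper bound $s(\nu)$ satisfies $$ s(\nu)=O\left(\sqrt{\frac{\nu v}{\tau}}\;v\right). $$
   Context: The network consists of $n$ mobile nodes in a square of area $\mathcal{A}=L\times L$ with $L\to\infty$, node density $\nu=n/\mathcal{A}$, node speed $v$, and node direction change rate $\tau$. For $0<\nu<1/\pi$, the propagation speed upper bound is the number $$ s(\nu)=\min\left\{\frac{\theta}{\rho}\;:\;\rho>0,\ \theta>0,\ 1-\nu\pi\tfrac{2}{\rho}I_1(\rho)>0,\ \theta=\sqrt{\rho^2v^2+\left(\tau+\frac{4\pi v\,\nu\, I_0(\rho)}{1-\nu\pi\frac{2}{\rho}I_1(\rho)}\right)^2}-\tau\right\}, $$ where $I_0(x)=\sum_{k\ge 0}\left(\frac{x}{2}\right)^{2k}\frac{1}{(k!)^2}$ and $I_1(x)=\sum_{k\ge 0}\left(\frac{x}{2}\right)^{2k+1}\frac{1}{(k+1)!\,k!}$ are modified Bessel functions. *)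

theory Defs
  imports Complex_Main "HOL-Library.Landau_Symbols"
begin

definition bessel_I0 :: "real \<Rightarrow> real" where
  "bessel_I0 x = (\<Sum>k. (x / 2) ^ (2 * k) * (1 / (fact k)\<^sup>2))"

definition bessel_I1 :: "real \<Rightarrow> real" where
  "bessel_I1 x = (\<Sum>k. (x / 2) ^ (2 * k + 1) * (1 / (fact (k + 1) * fact k)))"

definition speed_ratios :: "real \<Rightarrow> real \<Rightarrow> real \<Rightarrow> real set" where
  "speed_ratios v \<tau> \<nu> =
     {\<theta> / \<rho> | \<rho> \<theta>.
        \<rho> > 0 \<and> \<theta> > 0 \<and> 1 - \<nu> * pi * (2 / \<rho>) * bessel_I1 \<rho> > 0 \<and>
        \<theta> = sqrt (\<rho>\<^sup>2 * v\<^sup>2 +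
                 (\<tau> + 4 * pi * v * \<nu> * bessel_I0 \<rho> /
                       (1 - \<nu> * pi * (2 / \<rho>) * bessel_I1 \<rho>))\<^sup>2) - \<tau>}"

text \<open>
  The minimum of an infinite set: \<open>LEAST\<close> picks an attained minimum, and nothing can be
  derived about its value unless the minimum is shown to exist. Only the values for
  \<open>0 < \<nu> < 1 / pi\<close> are meaningful (for \<open>\<nu> \<ge> 1 / pi\<close> the set is empty).
\<close>

definition propagation_speed_bound :: "real \<Rightarrow> real \<Rightarrow> real \<Rightarrow> real" where
  "propagation_speed_bound v \<tau> \<nu> = (LEAST s. s \<in> speed_ratios v \<tau> \<nu>)"

end

theory Submission
  imports Defs
begin

text \<open>
  Since \<open>bessel_I0 \<rho> \<ge> 1\<close> and the denominator is at most \<open>1\<close>, the number \<open>\<theta>\<close> is bounded below by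
  \<open>4 * pi * v * \<nu>\<close>, and it blows up where the denominator vanishes. Hence the sublevel
  sets of \<open>\<theta> / \<rho>\<close> lie in compact subsets of the admissible range of \<open>\<rho>\<close>, and the minimum is
  attained. It is then estimated by the value at \<open>\<rho> = sqrt (\<nu> * \<tau> / v)\<close>, the scale that balances
  the contributions \<open>\<rho> * v\<^sup>2 / \<tau>\<close> and \<open>v * \<nu> / \<rho>\<close> coming from
  \<open>sqrt (\<tau>\<^sup>2 + x) - \<tau> \<le> x / (2 * \<tau>)\<close>.
\<close>

section \<open>Power series with coefficients between 0 and \<open>1 / fact k\<close>, compared with
  the exponential series\<close>

lemma summable_powser_le_exp:
  fixes c :: "nat \<Rightarrow> real"
  assumes "\<And>k. 0 \<le> c k" "\<And>k. c k \<le> 1 / fact k"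
  shows "summable (\<lambda>k. c k * y ^ k)"
proof (rule summable_comparison_test)
  show "summable (\<lambda>k. \<bar>y\<bar> ^ k /\<^sub>R fact k)"
    by (rule summable_exp_generic)
  show "\<exists>N. \<forall>k\<ge>N. norm (c k * y ^ k) \<le> \<bar>y\<bar> ^ k /\<^sub>R fact k"
    using mult_right_mono[OF assms(2), of "\<bar>y\<bar> ^ _"] assms(1)
    by (auto simp: abs_mult power_abs divide_inverse)
qed

lemma powser_le_exp:
  fixes c :: "nat \<Rightarrow> real"
  assumes "\<And>k. 0 \<le> c k" "\<And>k. c k \<le> 1 / fact k" "0 \<le> y"
  shows "(\<Sum>k. c k * y ^ k) \<le> exp y"
  unfolding exp_def
proof (rule suminf_le)
  show "summable (\<lambda>k. c k * y ^ k)"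
    by (rule summable_powser_le_exp[OF assms(1,2)])
  show "summable (\<lambda>k. y ^ k /\<^sub>R fact k)"
    by (rule summable_exp_generic)
  show "c k * y ^ k \<le> y ^ k /\<^sub>R fact k" for k
    using mult_right_mono[OF assms(2), of "y ^ k"] assms(3) by (simp add: divide_inverse)
qed

text \<open>All terms are nonnegative, so truncating after two of them bounds the sum from
  below.\<close>

lemma powser_ge_linear:
  fixes c :: "nat \<Rightarrow> real"
  assumes "\<And>k. 0 \<le> c k" "\<And>k. c k \<le> 1 / fact k" "0 \<le> y"
  shows "c 0 + c 1 * y \<le> (\<Sum>k. c k * y ^ k)"
proof -
  have "(\<Sum>k<2. c k * y ^ k) \<le> (\<Sum>k. c k * y ^ k)"
    by (rule sum_le_suminf[OF summable_powser_le_exp[OF assms(1,2)]]) (use assms in auto)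
  then show ?thesis
    by (simp add: numeral_2_eq_2)
qed

lemma continuous_on_powser_le_exp:
  fixes c :: "nat \<Rightarrow> real"
  assumes "\<And>k. 0 \<le> c k" "\<And>k. c k \<le> 1 / fact k"
  shows "continuous_on A (\<lambda>x. \<Sum>k. c k * ((x / 2)\<^sup>2) ^ k)"
proof -
  have "continuous_on UNIV (\<lambda>y. \<Sum>k. c k * y ^ k)"
    by (intro continuous_at_imp_continuous_on ballI isCont_powser_converges_everywhere
        summable_powser_le_exp assms)
  then show ?thesis
    by (rule continuous_on_compose2) (auto intro!: continuous_intros)
qed

text \<open>Supplies the coefficient bound for both Bessel series: \<open>m = k\<close> for
  \<open>bessel_I0\<close> and \<open>m = k + 1\<close> for \<open>bessel_I1\<close>.\<close>

lemma inverse_fact_mult_le: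
  "1 / (fact m * fact k) \<le> (1 / fact k :: real)"
  by (intro divide_left_mono) (auto simp: fact_ge_1)

section \<open>The Bessel functions as power series in \<open>(x / 2)\<^sup>2\<close>\<close>

lemma bessel_I0_powser:
  "bessel_I0 x = (\<Sum>k. 1 / (fact k * fact k) * ((x / 2)\<^sup>2) ^ k)"
  unfolding bessel_I0_def
  by (intro arg_cong[where f = suminf] ext) (simp add: power_mult power2_eq_square)

text \<open>This is \<open>2 * bessel_I1 x / x\<close>, extended by the value 1 at 0. It frees the
  admissibility condition from the division by \<open>\<rho>\<close> and is continuous
  everywhere.\<close>

definition bessel_I1_ratio :: "real \<Rightarrow> real" where
  "bessel_I1_ratio x = (\<Sum>k. 1 / (fact (k + 1) * fact k) * ((x / 2)\<^sup>2) ^ k)"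

lemma bessel_I1_eq_ratio:
  "bessel_I1 x = x / 2 * bessel_I1_ratio x"
proof -
  have "summable (\<lambda>k. 1 / (fact (k + 1) * fact k) * ((x / 2)\<^sup>2) ^ k)"
    by (rule summable_powser_le_exp[OF _ inverse_fact_mult_le]) simp
  then show ?thesis
    unfolding bessel_I1_ratio_def bessel_I1_def
    by (subst suminf_mult[symmetric])
      (auto intro!: arg_cong[where f = suminf] simp del: fact_Suc simp: power_mult[symmetric] mult_ac)
qed

lemma continuous_on_bessel_I0 [continuous_intros]: "continuous_on A bessel_I0"
  unfolding bessel_I0_powser[abs_def]
  by (rule continuous_on_powser_le_exp[OF _ inverse_fact_mult_le]) simp

lemma continuous_on_bessel_I1_ratio [continuous_intros]: "continuous_on A bessel_I1_ratio"
  unfolding bessel_I1_ratio_def[abs_def]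
  by (rule continuous_on_powser_le_exp[OF _ inverse_fact_mult_le]) simp

lemma bessel_I0_ge_1: "1 \<le> bessel_I0 x"
proof -
  have "1 + (x / 2)\<^sup>2 \<le> bessel_I0 x"
    using powser_ge_linear[where c = "\<lambda>k. 1 / (fact k * fact k)" and y = "(x / 2)\<^sup>2",
        OF _ inverse_fact_mult_le]
    by (simp add: bessel_I0_powser)
  then show ?thesis
    using zero_le_power2[of "x / 2"] by linarith
qed

text \<open>The first two coefficients are 1 and 1/2. The quadratic growth is what bounds the
  admissible \<open>\<rho>\<close> from above.\<close>

lemma bessel_I1_ratio_ge: "1 + x\<^sup>2 / 8 \<le> bessel_I1_ratio x"
  using powser_ge_linear[where c = "\<lambda>k. 1 / (fact (k + 1) * fact k)" and y = "(x / 2)\<^sup>2",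
      OF _ inverse_fact_mult_le]
  by (simp add: bessel_I1_ratio_def power_divide)

lemma exp_quarter_square_le_2:
  fixes x :: real
  assumes "\<bar>x\<bar> \<le> 1"
  shows "exp ((x / 2)\<^sup>2) \<le> 2"
proof -
  have "(x / 2)\<^sup>2 \<le> 1 / 4"
    using assms by (simp add: power_divide abs_square_le_1)
  moreover have "((x / 2)\<^sup>2)\<^sup>2 \<le> (1 / 4)\<^sup>2"
    using calculation by (intro power_mono) auto
  \<comment> \<open>For arguments in the unit interval \<open>exp_bound\<close> gives
    \<open>exp y \<le> 1 + y + y\<^sup>2\<close>, here at most 1 + 1/4 + 1/16.\<close>
  ultimately show ?thesis
    using exp_bound[of "(x / 2)\<^sup>2"] by (simp add: power2_eq_square[of "1/4"])
qed

lemma bessel_I0_le_2: "\<bar>x\<bar> \<le> 1 \<Longrightarrow> bessel_I0 x \<le> 2"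
  unfolding bessel_I0_powser
  by (rule order_trans[OF powser_le_exp[OF _ inverse_fact_mult_le] exp_quarter_square_le_2]) auto

lemma bessel_I1_ratio_le_2: "\<bar>x\<bar> \<le> 1 \<Longrightarrow> bessel_I1_ratio x \<le> 2"
  unfolding bessel_I1_ratio_def
  by (rule order_trans[OF powser_le_exp[OF _ inverse_fact_mult_le] exp_quarter_square_le_2]) auto

section \<open>The quotient \<open>\<theta> / \<rho>\<close> as a function of \<open>\<rho>\<close>
  alone\<close>

definition drift :: "real \<Rightarrow> real \<Rightarrow> real \<Rightarrow> real" where
  "drift v \<nu> \<rho> = 4 * pi * v * \<nu> * bessel_I0 \<rho> / (1 - \<nu> * pi * bessel_I1_ratio \<rho>)"

definition speed_ratio :: "real \<Rightarrow> real \<Rightarrow> real \<Rightarrow> real \<Rightarrow> real" where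
  "speed_ratio v \<tau> \<nu> \<rho> = (sqrt (\<rho>\<^sup>2 * v\<^sup>2 + (\<tau> + drift v \<nu> \<rho>)\<^sup>2) - \<tau>) / \<rho>"

text \<open>Both bounds come from \<open>bessel_I0_ge_1\<close>. The first records the blow-up at a
  vanishing denominator; the second, which keeps \<open>\<rho>\<close> away from 0, also uses that
  the denominator is at most 1.\<close>

lemma drift_bounds:
  assumes "v > 0" "\<nu> > 0" "1 - \<nu> * pi * bessel_I1_ratio \<rho> > 0"
  shows "4 * pi * v * \<nu> / (1 - \<nu> * pi * bessel_I1_ratio \<rho>) \<le> drift v \<nu> \<rho>"
    and "4 * pi * v * \<nu> \<le> drift v \<nu> \<rho>"
proof -
  let ?d = "1 - \<nu> * pi * bessel_I1_ratio \<rho>"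
  have "4 * pi * v * \<nu> * 1 \<le> 4 * pi * v * \<nu> * bessel_I0 \<rho>"
    using assms by (intro mult_left_mono bessel_I0_ge_1) auto
  then show *: "4 * pi * v * \<nu> / ?d \<le> drift v \<nu> \<rho>"
    unfolding drift_def using assms by (intro divide_right_mono) auto
  have "0 \<le> bessel_I1_ratio \<rho>"
    using bessel_I1_ratio_ge[of \<rho>] zero_le_power2[of \<rho>] by linarith
  then have "?d \<le> 1"
    using assms by simp
  then have "4 * pi * v * \<nu> / 1 \<le> 4 * pi * v * \<nu> / ?d"
    using assms by (intro divide_left_mono) auto
  with * show "4 * pi * v * \<nu> \<le> drift v \<nu> \<rho>"
    by simp
qed

text \<open>Dropping \<open>\<rho>\<^sup>2 * v\<^sup>2\<close> under the root leaves at least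
  \<open>\<tau> + drift v \<nu> \<rho>\<close>.\<close>

lemma drift_le_speed_ratio:
  assumes "\<rho> > 0"
  shows "drift v \<nu> \<rho> \<le> speed_ratio v \<tau> \<nu> \<rho> * \<rho>"
proof -
  have "\<tau> + drift v \<nu> \<rho> \<le> sqrt (\<rho>\<^sup>2 * v\<^sup>2 + (\<tau> + drift v \<nu> \<rho>)\<^sup>2)"
    by (rule real_le_rsqrt) simp
  then show ?thesis
    using assms by (simp add: speed_ratio_def)
qed

lemma speed_ratio_pos:
  assumes "v > 0" "\<nu> > 0" "\<rho> > 0" "1 - \<nu> * pi * bessel_I1_ratio \<rho> > 0"
  shows "0 < speed_ratio v \<tau> \<nu> \<rho>"
proof -
  have "0 < 4 * pi * v * \<nu>"
    using assms by simp
  then have "0 < speed_ratio v \<tau> \<nu> \<rho> * \<rho>"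
    using drift_bounds(2)[of v \<nu> \<rho>] drift_le_speed_ratio[of \<rho> v \<nu> \<tau>] assms by linarith
  then show ?thesis
    using assms by (simp add: zero_less_mult_iff)
qed

lemma speed_ratios_eq:
  assumes "v > 0" "\<nu> > 0"
  shows "speed_ratios v \<tau> \<nu> =
    speed_ratio v \<tau> \<nu> ` {\<rho>. \<rho> > 0 \<and> 1 - \<nu> * pi * bessel_I1_ratio \<rho> > 0}"
proof -
  have eq: "\<nu> * pi * (2 / \<rho>) * bessel_I1 \<rho> = \<nu> * pi * bessel_I1_ratio \<rho>" if "\<rho> > 0" for \<rho>
    using that by (simp add: bessel_I1_eq_ratio)
  have pos: "sqrt (\<rho>\<^sup>2 * v\<^sup>2 + (\<tau> + drift v \<nu> \<rho>)\<^sup>2) - \<tau> > 0"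
    if "\<rho> > 0" "1 - \<nu> * pi * bessel_I1_ratio \<rho> > 0" for \<rho>
    using speed_ratio_pos[OF assms that, of \<tau>] that by (simp add: speed_ratio_def zero_less_divide_iff)
  show ?thesis
  proof (intro set_eqI iffI)
    fix s assume "s \<in> speed_ratios v \<tau> \<nu>"
    then show "s \<in> speed_ratio v \<tau> \<nu> ` {\<rho>. \<rho> > 0 \<and> 1 - \<nu> * pi * bessel_I1_ratio \<rho> > 0}"
      \<comment> \<open>The deleted rules would pull the division out of the product and so hide the
        left-hand side of \<open>eq\<close>.\<close>
      unfolding speed_ratios_def by (auto simp: eq speed_ratio_def drift_def
          simp del: times_divide_eq_right times_divide_eq_left)
  next
    fix s assume "s \<in> speed_ratio v \<tau> \<nu> ` {\<rho>. \<rho> > 0 \<and> 1 - \<nu> * pi * bessel_I1_ratio \<rho> > 0}"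
    then obtain \<rho> where \<rho>: "\<rho> > 0" "1 - \<nu> * pi * bessel_I1_ratio \<rho> > 0"
      and s: "s = speed_ratio v \<tau> \<nu> \<rho>"
      by auto
    show "s \<in> speed_ratios v \<tau> \<nu>"
      unfolding speed_ratios_def mem_Collect_eq
      by (rule exI[of _ \<rho>], rule exI[of _ "sqrt (\<rho>\<^sup>2 * v\<^sup>2 + (\<tau> + drift v \<nu> \<rho>)\<^sup>2) - \<tau>"])
        (use \<rho> s pos[OF \<rho>] in \<open>auto simp: eq speed_ratio_def drift_def
            simp del: times_divide_eq_right times_divide_eq_left\<close>)
  qed
qed

section \<open>Existence of the minimum\<close>

lemma speed_ratio_attains_min:
  assumes v: "v > 0" and \<nu>: "\<nu> > 0"
    and r: "r > 0" "1 - \<nu> * pi * bessel_I1_ratio r > 0"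
  obtains m where "m > 0" "1 - \<nu> * pi * bessel_I1_ratio m > 0"
    "\<And>\<rho>. \<lbrakk>\<rho> > 0; 1 - \<nu> * pi * bessel_I1_ratio \<rho> > 0\<rbrakk> \<Longrightarrow> speed_ratio v \<tau> \<nu> m \<le> speed_ratio v \<tau> \<nu> \<rho>"
proof -
  define M where "M = speed_ratio v \<tau> \<nu> r"
  define c where "c = 4 * pi * v * \<nu>"
  \<comment> \<open>At \<open>R\<close> the lower bound
    \<open>\<nu> * pi * (\<rho>\<^sup>2 / 8)\<close> for the subtracted term reaches 1.\<close>
  define R where "R = sqrt (8 / (\<nu> * pi))"
  \<comment> \<open>A positive lower bound replaces the strict inequality on the denominator, which
    makes \<open>K\<close> closed while it still contains the sublevel set of
    \<open>M\<close>.\<close>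
  define K where "K = {c / M..R} \<inter> {\<rho>. c / (M * R) \<le> 1 - \<nu> * pi * bessel_I1_ratio \<rho>}"
  have M: "M > 0"
    unfolding M_def using assms by (intro speed_ratio_pos)
  have c: "c > 0" and R: "R > 0"
    using v \<nu> by (auto simp: c_def R_def)
  have inK: "\<rho> \<in> K"
    if \<rho>: "\<rho> > 0" "1 - \<nu> * pi * bessel_I1_ratio \<rho> > 0" and le: "speed_ratio v \<tau> \<nu> \<rho> \<le> M" for \<rho>
  proof -
    let ?d = "1 - \<nu> * pi * bessel_I1_ratio \<rho>"
    \<comment> \<open>Played against the two lower bounds for \<open>drift\<close>, this gives the
      left end of the interval and, once \<open>\<rho> \<le> R\<close> is known, the bound on the
      denominator.\<close>
    have drift_le: "drift v \<nu> \<rho> \<le> M * \<rho>"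
      using drift_le_speed_ratio[OF \<rho>(1), of v \<nu> \<tau>] mult_right_mono[OF le, of \<rho>] \<rho>(1) by linarith
    have "\<nu> * pi * (\<rho>\<^sup>2 / 8) \<le> \<nu> * pi * bessel_I1_ratio \<rho>"
      using bessel_I1_ratio_ge[of \<rho>] \<nu> by (intro mult_left_mono) auto
    then have "\<nu> * pi * (\<rho>\<^sup>2 / 8) \<le> 1"
      using \<rho>(2) by linarith
    then have upper: "\<rho> \<le> R"
      unfolding R_def using \<nu> by (intro real_le_rsqrt) (simp add: field_simps)
    have "c \<le> M * \<rho>"
      using drift_bounds(2)[OF v \<nu> \<rho>(2)] drift_le by (simp add: c_def)
    then have lower: "c / M \<le> \<rho>"
      using M by (simp add: field_simps)
    have "c / ?d \<le> M * R"
      using drift_bounds(1)[OF v \<nu> \<rho>(2)] drift_le mult_left_mono[OF upper, of M] M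
      unfolding c_def by linarith
    then have "c / (M * R) \<le> ?d"
      using M R \<rho>(2) by (simp add: field_simps)
    with upper lower show ?thesis
      by (simp add: K_def)
  qed
  have good: "\<rho> > 0" "1 - \<nu> * pi * bessel_I1_ratio \<rho> > 0" if "\<rho> \<in> K" for \<rho>
  proof -
    have "c / M > 0" "c / (M * R) > 0"
      using c M R by auto
    then show "\<rho> > 0" "1 - \<nu> * pi * bessel_I1_ratio \<rho> > 0"
      using that by (auto simp: K_def simp del: zero_less_divide_iff)
  qed
  have "compact K"
    unfolding K_def
    by (intro compact_Int_closed compact_Icc closed_Collect_le continuous_intros)
  moreover have "r \<in> K"
    using r by (intro inK) (auto simp: M_def)
  moreover have "continuous_on K (speed_ratio v \<tau> \<nu>)"
    unfolding speed_ratio_def[abs_def] drift_def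
    by (intro continuous_intros) (use good in force)+
  ultimately obtain m where m: "m \<in> K" "\<And>\<rho>. \<rho> \<in> K \<Longrightarrow> speed_ratio v \<tau> \<nu> m \<le> speed_ratio v \<tau> \<nu> \<rho>"
    using continuous_attains_inf[of K "speed_ratio v \<tau> \<nu>"] by blast
  show ?thesis
  proof (rule that[OF good[OF m(1)]])
    fix \<rho> assume \<rho>: "\<rho> > 0" "1 - \<nu> * pi * bessel_I1_ratio \<rho> > 0"
    show "speed_ratio v \<tau> \<nu> m \<le> speed_ratio v \<tau> \<nu> \<rho>"
    proof (cases "speed_ratio v \<tau> \<nu> \<rho> \<le> M")
      case True
      then show ?thesis using m(2)[OF inK[OF \<rho>]] by simp
    next
      \<comment> \<open>Outside the sublevel set the value exceeds \<open>M\<close>, which is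
        already attained at \<open>r\<close> in \<open>K\<close>.\<close>
      case False
      then show ?thesis using m(2)[OF \<open>r \<in> K\<close>] by (simp add: M_def)
    qed
  qed
qed

text \<open>The given \<open>\<rho>\<close> also serves as the starting point for the existence of a
  minimizer, which \<open>LEAST\<close> then evaluates to.\<close>

lemma propagation_speed_bound_le:
  assumes "v > 0" "\<nu> > 0" "\<rho> > 0" "1 - \<nu> * pi * bessel_I1_ratio \<rho> > 0"
  shows "0 < propagation_speed_bound v \<tau> \<nu>"
    and "propagation_speed_bound v \<tau> \<nu> \<le> speed_ratio v \<tau> \<nu> \<rho>"
proof -
  obtain m where m: "m > 0" "1 - \<nu> * pi * bessel_I1_ratio m > 0"
    and min: "\<And>\<rho>. \<lbrakk>\<rho> > 0; 1 - \<nu> * pi * bessel_I1_ratio \<rho> > 0\<rbrakk>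
      \<Longrightarrow> speed_ratio v \<tau> \<nu> m \<le> speed_ratio v \<tau> \<nu> \<rho>"
    using speed_ratio_attains_min[OF assms] by blast
  have "propagation_speed_bound v \<tau> \<nu> = speed_ratio v \<tau> \<nu> m"
    unfolding propagation_speed_bound_def speed_ratios_eq[OF assms(1,2)]
    by (rule Least_equality) (use m min in auto)
  then show "0 < propagation_speed_bound v \<tau> \<nu>"
    and "propagation_speed_bound v \<tau> \<nu> \<le> speed_ratio v \<tau> \<nu> \<rho>"
    using speed_ratio_pos[OF assms(1,2) m] min[OF assms(3,4)] by auto
qed

section \<open>The estimate at low density\<close>

lemma sqrt_add_sub_le:
  fixes \<tau> x :: real
  assumes "\<tau> > 0" "x \<ge> 0"
  shows "sqrt (\<tau>\<^sup>2 + x) - \<tau> \<le> x / (2 * \<tau>)"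
proof -
  \<comment> \<open>Expanding the square leaves the surplus
    \<open>(x / (2 * \<tau>))\<^sup>2\<close>.\<close>
  have "\<tau>\<^sup>2 + x \<le> (\<tau> + x / (2 * \<tau>))\<^sup>2"
    using assms by (simp add: power2_sum power2_eq_square field_simps)
  then have "sqrt (\<tau>\<^sup>2 + x) \<le> \<tau> + x / (2 * \<tau>)"
    using assms by (intro real_le_lsqrt) auto
  then show ?thesis by simp
qed

lemma speed_ratio_le:
  assumes "\<tau> > 0" "\<rho> > 0" "0 \<le> drift v \<nu> \<rho>" "drift v \<nu> \<rho> \<le> \<tau>"
  shows "speed_ratio v \<tau> \<nu> \<rho> \<le> \<rho> * v\<^sup>2 / (2 * \<tau>) + 3 / 2 * drift v \<nu> \<rho> / \<rho>"
proof -
  define B where "B = drift v \<nu> \<rho>"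
  have B: "0 \<le> B" "B \<le> \<tau>"
    using assms by (auto simp: B_def)
  have "sqrt (\<rho>\<^sup>2 * v\<^sup>2 + (\<tau> + B)\<^sup>2) - \<tau> = sqrt (\<tau>\<^sup>2 + (\<rho>\<^sup>2 * v\<^sup>2 + B * (2 * \<tau> + B))) - \<tau>"
    by (simp add: power2_eq_square algebra_simps)
  also have "\<dots> \<le> (\<rho>\<^sup>2 * v\<^sup>2 + B * (2 * \<tau> + B)) / (2 * \<tau>)"
    using assms B by (intro sqrt_add_sub_le) auto
  \<comment> \<open>Here \<open>B \<le> \<tau>\<close> linearizes the term quadratic in
    \<open>B\<close>; this is the source of the factor 3/2.\<close>
  also have "\<dots> \<le> (\<rho>\<^sup>2 * v\<^sup>2 + B * (3 * \<tau>)) / (2 * \<tau>)"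
    using assms B by (intro divide_right_mono add_left_mono mult_left_mono) auto
  also have "\<dots> = \<rho> * (\<rho> * v\<^sup>2 / (2 * \<tau>) + 3 / 2 * B / \<rho>)"
    using assms by (simp add: field_simps power2_eq_square)
  finally show ?thesis
    using assms by (simp add: speed_ratio_def B_def[symmetric] divide_le_eq mult.commute)
qed

text \<open>The three smallness conditions give, in order, \<open>\<rho> \<le> 1\<close> (so both
  Bessel factors are at most 2), a denominator of at least 1/2, and a drift of at most
  \<open>\<tau>\<close>.\<close>

lemma propagation_speed_bound_low_density:
  assumes v: "v > 0" and \<tau>: "\<tau> > 0" and \<nu>: "\<nu> > 0"
    and small: "\<nu> \<le> v / \<tau>" "\<nu> \<le> 1 / (4 * pi)" "\<nu> \<le> \<tau> / (16 * pi * v)"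
  shows "0 < propagation_speed_bound v \<tau> \<nu>"
    and "propagation_speed_bound v \<tau> \<nu> \<le> (1 / 2 + 24 * pi) * (sqrt (\<nu> * v / \<tau>) * v)"
proof -
  define \<rho> where "\<rho> = sqrt (\<nu> * \<tau> / v)"
  define q where "q = sqrt (\<nu> * v / \<tau>)"
  have \<rho>: "\<rho> > 0" "\<bar>\<rho>\<bar> \<le> 1"
    using v \<tau> \<nu> small(1) by (auto simp: \<rho>_def field_simps)
  \<comment> \<open>This identity and \<open>q * \<rho> = \<nu>\<close> turn the two terms of
    \<open>speed_ratio_le\<close> into multiples of \<open>q * v\<close>, with factors 1/2 and
    \<open>24 * pi\<close>.\<close>
  have \<rho>v: "\<rho> * v = q * \<tau>"
  proof -
    have "(\<rho> * v)\<^sup>2 = (q * \<tau>)\<^sup>2"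
      using v \<tau> \<nu> by (simp add: \<rho>_def q_def power_mult_distrib) (simp add: field_simps power2_eq_square)
    then show ?thesis
      using v \<tau> \<nu> by (simp add: \<rho>_def q_def power2_eq_iff_nonneg)
  qed
  have q\<rho>: "q * \<rho> = \<nu>"
    unfolding q_def \<rho>_def real_sqrt_mult[symmetric] using v \<tau> \<nu>
    by (simp add: real_sqrt_mult[symmetric])
  have "\<nu> * pi * bessel_I1_ratio \<rho> \<le> \<nu> * pi * 2"
    using \<nu> by (intro mult_left_mono bessel_I1_ratio_le_2 \<rho>) auto
  also have "\<dots> \<le> 1 / 2"
    using small(2) by (simp add: field_simps)
  finally have den: "1 - \<nu> * pi * bessel_I1_ratio \<rho> \<ge> 1 / 2"
    by simp
  then have den_pos: "1 - \<nu> * pi * bessel_I1_ratio \<rho> > 0"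
    by simp
  have "drift v \<nu> \<rho> \<le> (4 * pi * v * \<nu> * 2) / (1 / 2)"
    unfolding drift_def using den v \<nu> \<rho>
    by (intro frac_le mult_left_mono bessel_I0_le_2) auto
  then have drift_le: "drift v \<nu> \<rho> \<le> 16 * pi * v * \<nu>"
    by simp
  also have "\<dots> \<le> \<tau>"
    using small(3) v by (simp add: field_simps)
  finally have drift_le_tau: "drift v \<nu> \<rho> \<le> \<tau>" .
  have "0 \<le> 4 * pi * v * \<nu>"
    using v \<nu> by simp
  then have drift_nonneg: "0 \<le> drift v \<nu> \<rho>"
    using drift_bounds(2)[OF v \<nu> den_pos] by linarith
  show "0 < propagation_speed_bound v \<tau> \<nu>"
    by (rule propagation_speed_bound_le(1)[OF v \<nu> \<rho>(1) den_pos])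
  have "propagation_speed_bound v \<tau> \<nu> \<le> speed_ratio v \<tau> \<nu> \<rho>"
    by (rule propagation_speed_bound_le(2)[OF v \<nu> \<rho>(1) den_pos])
  also have "\<dots> \<le> \<rho> * v\<^sup>2 / (2 * \<tau>) + 3 / 2 * drift v \<nu> \<rho> / \<rho>"
    by (rule speed_ratio_le[OF \<tau> \<rho>(1) drift_nonneg drift_le_tau])
  also have "\<dots> \<le> \<rho> * v\<^sup>2 / (2 * \<tau>) + 3 / 2 * (16 * pi * v * \<nu>) / \<rho>"
    using drift_le \<rho>(1) by (intro add_left_mono divide_right_mono mult_left_mono) auto
  also have "\<rho> * v\<^sup>2 / (2 * \<tau>) = q * v / 2"
    using \<rho>v \<tau> by (simp add: power2_eq_square mult.assoc[symmetric])
  also have "3 / 2 * (16 * pi * v * \<nu>) / \<rho> = 24 * pi * (q * v)"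
    using \<rho>(1) by (simp add: q\<rho>[symmetric])
  finally show "propagation_speed_bound v \<tau> \<nu> \<le> (1 / 2 + 24 * pi) * (sqrt (\<nu> * v / \<tau>) * v)"
    by (simp add: q_def algebra_simps)
qed

theorem corollary1:
  fixes v \<tau> :: real
  assumes "v > 0" and "\<tau> > 0"
  shows "(\<lambda>\<nu>. propagation_speed_bound v \<tau> \<nu>) \<in> O[at_right 0](\<lambda>\<nu>. sqrt (\<nu> * v / \<tau>) * v)"
proof (rule bigoI)
  define b where "b = min (v / \<tau>) (min (1 / (4 * pi)) (\<tau> / (16 * pi * v)))"
  have "b > 0"
    using assms by (simp add: b_def)
  \<comment> \<open>As \<open>b\<close> depends only on \<open>v\<close> and \<open>\<tau>\<close>,
    all three smallness conditions hold on a fixed right neighbourhood of 0.\<close>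
  then have "eventually (\<lambda>\<nu>. \<nu> \<in> {0<..<b}) (at_right 0)"
    by (rule eventually_at_right_real)
  then show "eventually (\<lambda>\<nu>. norm (propagation_speed_bound v \<tau> \<nu>)
      \<le> (1 / 2 + 24 * pi) * norm (sqrt (\<nu> * v / \<tau>) * v)) (at_right 0)"
  proof eventually_elim
    case (elim \<nu>)
    then have "\<nu> > 0" "\<nu> \<le> v / \<tau>" "\<nu> \<le> 1 / (4 * pi)" "\<nu> \<le> \<tau> / (16 * pi * v)"
      by (auto simp: b_def)
    from propagation_speed_bound_low_density[OF assms this] show ?case
      using assms \<open>\<nu> > 0\<close> by (simp add: abs_mult)
  qed
qed

end
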